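(* Let $X$ and $Y$ be real linear spaces, let $D\subseteq X$ be a nonempty convex subset, and let $f:D\to Y$ be a strict inversely convexity preserving function, i.e., $f(]x,y[)\subseteq\,]f(x),f(y)[$ for all $x,y\in D$. Assume that $f(D)$ is non-collinear, i.e., it contains three points forming a nondegenerate triangle. Then there exist a linear operator $A:X\to Y$, a linear function $B:X\to\mathbb{R}$, a vector $a\in Y$, and a scalar $b\in\mathbb{R}$ such that $$B(x)+b>0\quad\text{for all } x\in D$$ and $$f(x)=\frac{A(x)+a}{B(x)+b}\qquad (x\in D).$$
   Context: For points $u,v$ of a real linear space, the open segment is $]u,v[\,:=\{tu+(1-t)v\mid 0<t<1\}$; in particular $]u,u[\,=\{u\}$. A map $f:D\to Y$ on a convex set $D\subseteq X$ is called strict inversely convexity preserving if $f(]x,y[)\subseteq\,]f(x),f(y)[$ for all $x,y\in D$. A set is non-collinear if it contains three points not lying on a common line. *)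

theory Defs
  imports "HOL-Analysis.Analysis"
begin

text \<open>
  The library constant \<^const>\<open>open_segment\<close> removes both endpoints, so that its value at \<open>u, u\<close>
  is empty. Here the open segment is the set of proper convex combinations, and the open segment
  from \<open>u\<close> to \<open>u\<close> is \<open>{u}\<close>.
\<close>

definition oseg :: "'a::real_vector \<Rightarrow> 'a \<Rightarrow> 'a set" where
  "oseg u v = {t *\<^sub>R u + (1 - t) *\<^sub>R v | t::real. 0 < t \<and> t < 1}"

definition strict_inv_convexity_preserving ::
    "'a::real_vector set \<Rightarrow> ('a \<Rightarrow> 'b::real_vector) \<Rightarrow> bool" where
  "strict_inv_convexity_preserving D f \<longleftrightarrow>
     (\<forall>x\<in>D. \<forall>y\<in>D. f ` oseg x y \<subseteq> oseg (f x) (f y))"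

definition non_collinear :: "'a::real_vector set \<Rightarrow> bool" where
  "non_collinear S \<longleftrightarrow> (\<exists>p\<in>S. \<exists>q\<in>S. \<exists>r\<in>S. \<not> collinear {p, q, r})"

end

theory Submission
  imports Defs
begin

text \<open>
  On a segment from \<open>x\<close> to \<open>y\<close> with \<open>f x \<noteq> f y\<close>, \<open>f\<close> turns a ratio \<open>s\<close> of weights into a ratio
  \<open>\<phi> s\<close>. If \<open>f x, f y, f z\<close> is a nondegenerate triangle, Ceva's theorem forces \<open>\<phi>\<close> to be a constant
  multiple of a multiplicative function \<open>\<psi>\<close>, common to the sides of the triangle. Segments joining two
  sides give \<open>\<psi> (1 + t) = 1 + \<psi> t\<close>, so \<open>\<psi>\<close> is the identity and \<open>\<phi> s = \<rho> x y * s\<close>. Ceva's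
  theorem also yields the cocycle equation \<open>\<rho> x z = \<rho> x y * \<rho> y z\<close>, hence
  \<open>\<rho> x y = g x / g y\<close> for a positive function \<open>g\<close>. Then \<open>g\<close> and \<open>g f\<close> are affine on \<open>D\<close>: they are the
  denominator and the numerator.
\<close>

section \<open>Weighted means\<close>

text \<open>Weights are homogeneous: only their ratio matters, so they can be rescaled and regrouped
  without fractions. If \<open>a + b = 0\<close> the value is the junk value 0.\<close>

definition wmean :: "real \<Rightarrow> 'a \<Rightarrow> real \<Rightarrow> 'a \<Rightarrow> 'a::real_vector" where
  "wmean a x b y = (a *\<^sub>R x + b *\<^sub>R y) /\<^sub>R (a + b)"

lemma scaleR_wmean: "a + b \<noteq> 0 \<Longrightarrow> (a + b) *\<^sub>R wmean a x b y = a *\<^sub>R x + b *\<^sub>R y"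
  by (simp add: wmean_def)

lemma wmean_eqI: "a + b \<noteq> 0 \<Longrightarrow> (a + b) *\<^sub>R p = a *\<^sub>R x + b *\<^sub>R y \<Longrightarrow> wmean a x b y = p"
  by (metis scaleR_cancel_left scaleR_wmean)

lemma wmean_commute: "wmean a x b y = wmean b y a x"
  by (simp add: wmean_def add.commute)

lemma wmean_scale: "k \<noteq> 0 \<Longrightarrow> wmean (k * a) x (k * b) y = wmean a x b y"
proof -
  assume "k \<noteq> 0"
  have "(k * a) *\<^sub>R x + (k * b) *\<^sub>R y = k *\<^sub>R (a *\<^sub>R x + b *\<^sub>R y)"
    by (simp add: scaleR_add_right)
  moreover have "k * a + k * b = k * (a + b)"
    by (simp add: distrib_left)
  ultimately show ?thesis
    using \<open>k \<noteq> 0\<close> by (simp add: wmean_def)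
qed

text \<open>Multiplied by the total weight, both sides become
  \<open>a *\<^sub>R x + b *\<^sub>R y + c *\<^sub>R z\<close>.\<close>

lemma wmean_assoc:
  assumes "a > 0" "b > 0" "c > 0"
  shows "wmean (a + b) (wmean a x b y) c z = wmean a x (b + c) (wmean b y c z)"
  by (rule wmean_eqI) (use assms in \<open>simp_all add: scaleR_wmean add.assoc\<close>)

lemma wmean_in_convex:
  assumes "convex D" "x \<in> D" "y \<in> D" "a > 0" "b > 0"
  shows "wmean a x b y \<in> D"
proof -
  have "wmean a x b y = (a / (a + b)) *\<^sub>R x + (b / (a + b)) *\<^sub>R y"
    by (simp add: wmean_def scaleR_add_right divide_inverse mult.commute)
  then show ?thesis
    using assms by (simp add: convex_def add_divide_distrib[symmetric])
qed

lemma oseg_eq_wmean: "oseg x y = {wmean a x b y | a b. a > 0 \<and> b > 0}"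
proof (intro set_eqI iffI)
  fix p assume "p \<in> oseg x y"
  then obtain t where t: "0 < t" "t < 1" "p = t *\<^sub>R x + (1 - t) *\<^sub>R y"
    unfolding oseg_def by blast
  then have "p = wmean t x (1 - t) y"
    by (simp add: wmean_def)
  with t show "p \<in> {wmean a x b y | a b. a > 0 \<and> b > 0}"
    by (metis (mono_tags, lifting) diff_gt_0_iff_gt mem_Collect_eq)
next
  fix p assume "p \<in> {wmean a x b y | a b. a > 0 \<and> b > 0}"
  then obtain a b where ab: "a > 0" "b > 0" "p = wmean a x b y"
    by blast
  have "p = (a / (a + b)) *\<^sub>R x + (1 - a / (a + b)) *\<^sub>R y"
  proof -
    have "1 - a / (a + b) = b / (a + b)"
      using ab by (simp add: field_simps)
    then show ?thesis
      using ab by (simp add: wmean_def scaleR_add_right divide_inverse mult.commute)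
  qed
  moreover have "0 < a / (a + b)" "a / (a + b) < 1"
    using ab by simp_all
  ultimately show "p \<in> oseg x y"
    unfolding oseg_def by blast
qed

section \<open>Barycentric coordinates\<close>

text \<open>Otherwise dividing by \<open>c\<close> would express \<open>Z\<close> as an affine
  combination of \<open>X\<close> and \<open>Y\<close>.\<close>

lemma not_collinear_coeff_zero:
  assumes "\<not> collinear {X, Y, Z}" "a + b + c = 0" "a *\<^sub>R X + b *\<^sub>R Y + c *\<^sub>R Z = 0"
  shows "c = 0"
proof (rule ccontr)
  assume c: "c \<noteq> 0"
  have "c *\<^sub>R Z = c *\<^sub>R ((- a / c) *\<^sub>R X + (1 - (- a / c)) *\<^sub>R Y)"
  proof -
    have "c * (1 - (- a / c)) = c + a"
      using c by (simp add: field_simps)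
    then have "c * (1 - (- a / c)) = - b"
      using assms(2) by linarith
    then have "c *\<^sub>R ((- a / c) *\<^sub>R X + (1 - (- a / c)) *\<^sub>R Y) = - (a *\<^sub>R X) - b *\<^sub>R Y"
      using c by (simp only: scaleR_add_right scaleR_scaleR) simp
    then show ?thesis
      using assms(3) by (metis add_diff_eq add_eq_0_iff diff_minus_eq_add minus_add_distrib
          uminus_add_conv_diff add.commute)
  qed
  then have "Z = (- a / c) *\<^sub>R X + (1 - (- a / c)) *\<^sub>R Y"
    using c by (metis scaleR_cancel_left)
  then have "collinear {X, Z, Y}"
    unfolding collinear_3_expand by blast
  with assms(1) show False
    by (simp add: insert_commute)
qed

lemma not_collinear_coeffs_zero:
  assumes "\<not> collinear {X, Y, Z}" "a + b + c = 0" "a *\<^sub>R X + b *\<^sub>R Y + c *\<^sub>R Z = 0"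
  shows "a = 0" "b = 0" "c = 0"
proof -
  show "c = 0"
    using not_collinear_coeff_zero[OF assms] .
  have "\<not> collinear {Y, Z, X}" "\<not> collinear {X, Z, Y}"
    using assms(1) by (simp_all add: insert_commute)
  then show "a = 0" "b = 0"
    using not_collinear_coeff_zero[of Y Z X b c a] not_collinear_coeff_zero[of X Z Y a c b] assms(2,3)
    by (simp_all add: ac_simps)
qed

text \<open>Homogeneous barycentric coordinates are unique up to a common factor, stated by cross
  products. Scaling each representation by the total of the other and subtracting leaves an affine
  relation between the vertices.\<close>

lemma barycentric_unique:
  assumes "\<not> collinear {X, Y, Z}" "a + b + c \<noteq> 0" "a' + b' + c' \<noteq> 0"
    and F: "(a + b + c) *\<^sub>R F = a *\<^sub>R X + b *\<^sub>R Y + c *\<^sub>R Z"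
    and F': "(a' + b' + c') *\<^sub>R F = a' *\<^sub>R X + b' *\<^sub>R Y + c' *\<^sub>R Z"
  shows "a * b' = a' * b" "b * c' = b' * c" "c * a' = c' * a"
proof -
  define s s' where "s = a + b + c" and "s' = a' + b' + c'"
  have "s' *\<^sub>R (s *\<^sub>R F) - s *\<^sub>R (s' *\<^sub>R F) = 0"
    by (simp add: mult.commute)
  then have "(s' * a - s * a') *\<^sub>R X + (s' * b - s * b') *\<^sub>R Y + (s' * c - s * c') *\<^sub>R Z = 0"
    unfolding F[folded s_def] F'[folded s'_def] by (simp add: algebra_simps)
  moreover have "(s' * a - s * a') + (s' * b - s * b') + (s' * c - s * c') = 0"
    unfolding s_def s'_def by (simp add: algebra_simps)
  ultimately have "s' * a - s * a' = 0" "s' * b - s * b' = 0" "s' * c - s * c' = 0"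
    using not_collinear_coeffs_zero[OF assms(1)] by blast+
  moreover have "s \<noteq> 0" "s' \<noteq> 0"
    using assms(2,3) by (simp_all add: s_def s'_def)
  ultimately have k: "a = (s / s') * a'" "b = (s / s') * b'" "c = (s / s') * c'"
    by (simp_all add: field_simps)
  show "a * b' = a' * b" "b * c' = b' * c" "c * a' = c' * a"
    by (subst k, subst k, simp)+
qed

section \<open>Multiplicative functions on the positive reals\<close>

text \<open>Writing \<open>s + t = s * (1 + t / s)\<close> turns the shift rule into additivity.
  Additivity and positivity give monotonicity and fix the positive rationals, whose density does the
  rest.\<close>

lemma multiplicative_additive_shift_eq_id:
  fixes \<psi> :: "real \<Rightarrow> real"
  assumes pos: "\<And>s. s > 0 \<Longrightarrow> \<psi> s > 0"
    and mult: "\<And>s t. s > 0 \<Longrightarrow> t > 0 \<Longrightarrow> \<psi> (s * t) = \<psi> s * \<psi> t"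
    and shift: "\<And>t. t > 0 \<Longrightarrow> \<psi> (1 + t) = 1 + \<psi> t"
    and "s > 0"
  shows "\<psi> s = s"
proof -
  have add: "\<psi> (s + t) = \<psi> s + \<psi> t" if "s > 0" "t > 0" for s t
  proof -
    have "\<psi> (s * (1 + t / s)) = \<psi> s * (1 + \<psi> (t / s))"
      using that mult[of s "1 + t / s"] shift[of "t / s"] by (simp add: add_pos_pos)
    also have "\<dots> = \<psi> s + \<psi> (s * (t / s))"
      using that by (simp only: mult divide_pos_pos distrib_left mult_1_right)
    finally show ?thesis
      using that by (simp add: distrib_left)
  qed
  have one: "\<psi> 1 = 1"
    using mult[of 1 1] pos[of 1] by simp
  have nat: "\<psi> (real (Suc n)) = real (Suc n)" for n
  proof (induction n)
    case (Suc n)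
    then show ?case
      using add[of "real (Suc n)" 1] one by (simp add: add.commute)
  qed (simp add: one)
  have rat: "\<psi> r = r" if r: "r \<in> \<rat>" "r > 0" for r
  proof -
    obtain m n where mn: "n \<noteq> 0" "\<bar>r\<bar> = real m / real n"
      using Rats_abs_nat_div_natE[OF r(1)] by metis
    with r have "m \<noteq> 0"
      by (cases "m = 0") auto
    have "\<psi> (r * real n) = \<psi> r * \<psi> (real n)"
      using mn r by (intro mult) auto
    moreover have "r * real n = real m"
      using mn r by simp
    moreover have "\<psi> (real n) = real n" "\<psi> (real m) = real m"
      using nat[of "n - 1"] nat[of "m - 1"] mn \<open>m \<noteq> 0\<close> by simp_all
    ultimately have "\<psi> r * real n = r * real n"
      by metis
    then show ?thesis
      using mn(1) by (metis mult_right_cancel of_nat_eq_0_iff)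
  qed
  have mono: "\<psi> s < \<psi> t" if "0 < s" "s < t" for s t
    using add[of s "t - s"] pos[of "t - s"] that by simp
  show ?thesis
  proof (rule ccontr)
    assume "\<psi> s \<noteq> s"
    then consider "\<psi> s < s" | "s < \<psi> s"
      by linarith
    then show False
    proof cases
      case 1
      then obtain r where "r \<in> \<rat>" "\<psi> s < r" "r < s"
        using Rats_dense_in_real by blast
      then show False
        using mono[of r s] rat[of r] pos[of s] \<open>s > 0\<close> by auto
    next
      case 2
      then obtain r where "r \<in> \<rat>" "s < r" "r < \<psi> s"
        using Rats_dense_in_real by blast
      then show False
        using mono[of s r] rat[of r] \<open>s > 0\<close> by auto
    qed
  qed
qed

section \<open>Extension of affine functions\<close>

text \<open>At height one in the product with the reals an affine map becomes linear. A linear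
  \<open>L\<close> agreeing with \<open>h\<close> on a maximal independent subset \<open>B\<close>
  of the lifted \<open>D\<close> is shown to agree on all of \<open>D\<close>; \<open>A\<close> is
  \<open>L\<close> at height zero and \<open>c\<close> is \<open>L (0, 1)\<close>.\<close>

lemma affine_on_convex_extend:
  fixes D :: "'a::real_vector set" and h :: "'a \<Rightarrow> 'b::real_vector"
  assumes "convex D" "D \<noteq> {}"
    and h: "\<And>x y a b. x \<in> D \<Longrightarrow> y \<in> D \<Longrightarrow> a > 0 \<Longrightarrow> b > 0 \<Longrightarrow>
              h (wmean a x b y) = wmean a (h x) b (h y)"
  obtains A c where "linear A" "\<And>x. x \<in> D \<Longrightarrow> h x = A x + c"
proof -
  obtain B where B: "B \<subseteq> D \<times> {1::real}" "independent B" "D \<times> {1} \<subseteq> span B"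
    using maximal_independent_subset by blast
  obtain L where L: "linear L" "\<And>p. p \<in> B \<Longrightarrow> L p = h (fst p)"
    using linear_independent_extend[OF B(2), of "\<lambda>p. h (fst p)"] by blast
  define K where "K x = h x - L (x, 1)" for x
  have L_wmean: "L (wmean a x b y, 1) = wmean a (L (x, 1)) b (L (y, 1))" if "a > 0" "b > 0" for a b x y
  proof -
    have "(wmean a x b y, 1) = wmean a (x, 1::real) b (y, 1)"
      using that by (simp add: wmean_def)
    then show ?thesis
      by (simp only: wmean_def linear_add[OF L(1)] linear_cmul[OF L(1)])
  qed
  have K: "K (wmean a x b y) = wmean a (K x) b (K y)"
    if "x \<in> D" "y \<in> D" "a > 0" "b > 0" for x y a b
    unfolding K_def h[OF that] L_wmean[OF that(3,4)] by (simp add: wmean_def algebra_simps)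
  define Z where "Z = {x \<in> D. K x = 0}"
  have Z: "wmean a x b y \<in> Z" if "x \<in> Z" "y \<in> Z" "a > 0" "b > 0" for x y a b
    using that K wmean_in_convex[OF \<open>convex D\<close>] by (simp add: Z_def) (simp add: wmean_def)
  txt \<open>Convexity of \<open>Z\<close> makes the set of differences of its cone a subspace.\<close>
  define S where "S = {a *\<^sub>R (c, 1::real) - b *\<^sub>R (d, 1) | a b c d. a > 0 \<and> b > 0 \<and> c \<in> Z \<and> d \<in> Z}"
  have BZ: "fst p \<in> Z \<and> snd p = 1" if "p \<in> B" for p
    using that B(1) L(2)[OF that] by (cases p) (auto simp: Z_def K_def)
  have "B \<noteq> {}"
  proof
    assume "B = {}"
    obtain d where "d \<in> D"
      using \<open>D \<noteq> {}\<close> by blast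
    then have "(d, 1) \<in> span B"
      using B(3) by blast
    then show False
      by (simp add: \<open>B = {}\<close> zero_prod_def)
  qed
  then obtain e where e: "e \<in> Z"
    using BZ by blast
  have S_diff: "a *\<^sub>R (c, 1) - b *\<^sub>R (d, 1) \<in> S" if "a > 0" "b > 0" "c \<in> Z" "d \<in> Z" for a b c d
    using that unfolding S_def by blast
  have "subspace S"
  proof (rule subspaceI)
    show zero: "0 \<in> S"
      using S_diff[OF zero_less_one zero_less_one e e] by simp
    show "p + q \<in> S" if pq: "p \<in> S" "q \<in> S" for p q
    proof -
      obtain a b c d where p: "p = a *\<^sub>R (c, 1) - b *\<^sub>R (d, 1)" "a > 0" "b > 0" "c \<in> Z" "d \<in> Z"
        using pq unfolding S_def by blast
      obtain a' b' c' d' where q: "q = a' *\<^sub>R (c', 1) - b' *\<^sub>R (d', 1)" "a' > 0" "b' > 0" "c' \<in> Z" "d' \<in> Z"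
        using pq unfolding S_def by blast
      have "p + q = (a + a') *\<^sub>R (wmean a c a' c', 1) - (b + b') *\<^sub>R (wmean b d b' d', 1)"
        using p(2,3) q(2,3) by (simp add: p(1) q(1) scaleR_wmean)
      also have "\<dots> \<in> S"
        using p q by (intro S_diff Z) auto
      finally show ?thesis .
    qed
    show "k *\<^sub>R p \<in> S" if pS: "p \<in> S" for k p
    proof -
      obtain a b c d where p: "p = a *\<^sub>R (c, 1) - b *\<^sub>R (d, 1)" "a > 0" "b > 0" "c \<in> Z" "d \<in> Z"
        using pS unfolding S_def by blast
      consider "k = 0" | "k > 0" | "k < 0"
        by linarith
      then show ?thesis
      proof cases
        case 2
        then have "(k * a) *\<^sub>R (c, 1) - (k * b) *\<^sub>R (d, 1) \<in> S"
          using p by (intro S_diff) auto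
        then show ?thesis
          by (simp add: p(1) algebra_simps)
      next
        case 3
        \<comment> \<open>A negative factor exchanges the two parts of the difference, keeping both
          coefficients positive.\<close>
        then have "((- k) * b) *\<^sub>R (d, 1) - ((- k) * a) *\<^sub>R (c, 1) \<in> S"
          using p by (intro S_diff) (auto simp: mult_neg_pos)
        then show ?thesis
          by (simp add: p(1) algebra_simps)
      qed (use zero in simp)
    qed
  qed
  moreover have "B \<subseteq> S"
  proof
    fix p assume "p \<in> B"
    then have "fst p \<in> Z" "p = (fst p, 1)"
      using BZ by (auto simp: prod_eq_iff)
    moreover have "p = 2 *\<^sub>R (fst p, 1) - 1 *\<^sub>R (fst p, 1)"
      using \<open>p = (fst p, 1)\<close> by (simp add: prod_eq_iff scaleR_2)
    ultimately show "p \<in> S"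
      using S_diff[of 2 1] by (metis zero_less_numeral zero_less_one)
  qed
  ultimately have span: "span B \<subseteq> S"
    by (simp add: span_minimal)
  have "K x = 0" if x: "x \<in> D" for x
  proof -
    have "(x, 1) \<in> S"
      using x B(3) span by blast
    then obtain a b c d where ab: "(x, 1) = a *\<^sub>R (c, 1::real) - b *\<^sub>R (d, 1)" "a > 0" "b > 0" "c \<in> Z" "d \<in> Z"
      unfolding S_def by blast
    \<comment> \<open>Comparing heights gives \<open>a = 1 + b\<close>, so \<open>c\<close> is a
      proper mean of \<open>x\<close> and \<open>d\<close>. As \<open>K\<close> vanishes at
      \<open>c\<close> and \<open>d\<close>, it vanishes at \<open>x\<close>.\<close>
    then have "a = 1 + b" "1 *\<^sub>R x + b *\<^sub>R d = (1 + b) *\<^sub>R c"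
      by simp_all
    then have "wmean 1 x b d = c"
      using ab by (intro wmean_eqI) auto
    then have "K c = wmean 1 (K x) b (K d)"
      using K[OF x, of d 1 b] ab by (simp add: Z_def)
    then show ?thesis
      using ab by (simp add: Z_def wmean_def)
  qed
  then have "h x = L (x, 0) + L (0, 1)" if "x \<in> D" for x
    using that linear_add[OF L(1), of "(x, 0)" "(0, 1)"] by (simp add: K_def)
  moreover have "linear (\<lambda>x. L (x, 0))"
  proof (rule linearI)
    show "L (x + y, 0) = L (x, 0) + L (y, 0)" for x y
      using linear_add[OF L(1), of "(x, 0)" "(y, 0)"] by simp
    show "L (k *\<^sub>R x, 0) = k *\<^sub>R L (x, 0)" for k x
      using linear_cmul[OF L(1), of k "(x, 0)"] by simp
  qed
  ultimately show thesis
    using that by blast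
qed

section \<open>Uniqueness of two weights, and means of three points\<close>

lemma wmean_unique:
  assumes "x \<noteq> y" "a + b \<noteq> 0" "a' + b' \<noteq> 0" "wmean a x b y = wmean a' x b' y"
  shows "a * b' = a' * b"
proof -
  define p where "p = wmean a x b y"
  have p: "(a + b) *\<^sub>R p = a *\<^sub>R x + b *\<^sub>R y" "(a' + b') *\<^sub>R p = a' *\<^sub>R x + b' *\<^sub>R y"
    using assms scaleR_wmean[of a b x y] scaleR_wmean[of a' b' x y] by (simp_all add: p_def)
  have "(a' + b') *\<^sub>R ((a + b) *\<^sub>R p) - (a + b) *\<^sub>R ((a' + b') *\<^sub>R p) = 0"
    by (simp add: mult.commute)
  then have "(a * b' - a' * b) *\<^sub>R (x - y) = 0"
    unfolding p by (simp add: algebra_simps)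
  then show ?thesis
    using \<open>x \<noteq> y\<close> by simp
qed

text \<open>The nesting places the point on the cevian from \<open>z\<close>; for positive weights
  the value is symmetric in the three weighted points.\<close>

definition wmean3 :: "real \<Rightarrow> 'a \<Rightarrow> real \<Rightarrow> 'a \<Rightarrow> real \<Rightarrow> 'a \<Rightarrow> 'a::real_vector" where
  "wmean3 a x b y c z = wmean (a + b) (wmean a x b y) c z"

lemma wmean3_rotate:
  assumes "a > 0" "b > 0" "c > 0"
  shows "wmean3 a x b y c z = wmean3 b y c z a x"
  unfolding wmean3_def using wmean_assoc[OF assms] by (simp add: wmean_commute)

section \<open>The distortion of ratios\<close>

locale noncollinear_icp =
  fixes D :: "'a::real_vector set" and f :: "'a \<Rightarrow> 'b::real_vector"
  assumes convex: "convex D"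
    and strict: "strict_inv_convexity_preserving D f"
    and noncollinear: "non_collinear (f ` D)"
begin

lemma wmean_in: "x \<in> D \<Longrightarrow> y \<in> D \<Longrightarrow> a > 0 \<Longrightarrow> b > 0 \<Longrightarrow> wmean a x b y \<in> D"
  using wmean_in_convex[OF convex] .

lemma image_wmean:
  assumes "x \<in> D" "y \<in> D" "a > 0" "b > 0"
  obtains c d where "c > 0" "d > 0" "f (wmean a x b y) = wmean c (f x) d (f y)"
proof -
  have "wmean a x b y \<in> oseg x y"
    using assms(3,4) by (auto simp: oseg_eq_wmean)
  then have "f (wmean a x b y) \<in> oseg (f x) (f y)"
    using strict assms(1,2) by (auto simp: strict_inv_convexity_preserving_def)
  then show thesis
    using that by (auto simp: oseg_eq_wmean)
qed

text \<open>On a segment with \<open>f x \<noteq> f y\<close> the weights \<open>s : 1\<close> are turned into the weights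
  \<open>ratio x y s : 1\<close>. If \<open>f x = f y\<close>, the value is an arbitrary positive number.\<close>

definition ratio :: "'a \<Rightarrow> 'a \<Rightarrow> real \<Rightarrow> real" where
  "ratio x y s = (SOME r. r > 0 \<and> f (wmean s x 1 y) = wmean r (f x) 1 (f y))"

lemma
  assumes "x \<in> D" "y \<in> D" "s > 0"
  shows ratio_pos: "ratio x y s > 0"
    and image_wmean_1: "f (wmean s x 1 y) = wmean (ratio x y s) (f x) 1 (f y)"
proof -
  obtain c d where cd: "c > 0" "d > 0" "f (wmean s x 1 y) = wmean c (f x) d (f y)"
    using image_wmean[of x y s 1] assms by auto
  have "c / d > 0 \<and> f (wmean s x 1 y) = wmean (c / d) (f x) 1 (f y)"
    using cd wmean_scale[of "1 / d" c "f x" d "f y"] by simp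
  then have "ratio x y s > 0 \<and> f (wmean s x 1 y) = wmean (ratio x y s) (f x) 1 (f y)"
    unfolding ratio_def by (rule someI)
  then show "ratio x y s > 0" "f (wmean s x 1 y) = wmean (ratio x y s) (f x) 1 (f y)"
    by blast+
qed

lemma image_wmean_ratio:
  assumes "x \<in> D" "y \<in> D" "a > 0" "b > 0"
  shows "f (wmean a x b y) = wmean (ratio x y (a / b)) (f x) 1 (f y)"
  using image_wmean_1[of x y "a / b"] wmean_scale[of "1 / b" a x b y] assms by simp

section \<open>Ceva's theorem for the image of a triangle\<close>

text \<open>Strictness is applied on the side from \<open>x\<close> to \<open>y\<close>, then on the
  segment from the point found there to \<open>z\<close>. The image thus lies on a cevian with known
  foot.\<close>

lemma cevian:
  assumes "x \<in> D" "y \<in> D" "z \<in> D" "a > 0" "b > 0" "c > 0"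
  obtains k d where "k > 0" "d > 0"
    "(ratio x y (a / b) * k + k + d) *\<^sub>R f (wmean3 a x b y c z) =
      (ratio x y (a / b) * k) *\<^sub>R f x + k *\<^sub>R f y + d *\<^sub>R f z"
proof -
  define r where "r = ratio x y (a / b)"
  have r: "r > 0"
    using assms ratio_pos by (simp add: r_def)
  obtain k d where kd: "k > 0" "d > 0"
    "f (wmean3 a x b y c z) = wmean k (f (wmean a x b y)) d (f z)"
    unfolding wmean3_def using image_wmean[of "wmean a x b y" z "a + b" c] assms wmean_in
    by (metis add_pos_pos)
  \<comment> \<open>The foot has weights \<open>r : 1\<close>, of total \<open>r + 1\<close>; its
    weight \<open>k\<close> is split accordingly between \<open>f x\<close> and
    \<open>f y\<close>.\<close>
  define k' where "k' = k / (r + 1)"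
  have k': "k = k' * (r + 1)" "k' > 0"
    using r kd by (simp_all add: k'_def)
  have "(k + d) *\<^sub>R f (wmean3 a x b y c z) = k *\<^sub>R wmean r (f x) 1 (f y) + d *\<^sub>R f z"
    using kd assms by (simp add: scaleR_wmean image_wmean_ratio r_def)
  also have "k *\<^sub>R wmean r (f x) 1 (f y) = k' *\<^sub>R (r *\<^sub>R f x + 1 *\<^sub>R f y)"
    using r by (simp only: k'(1) scaleR_scaleR[symmetric] scaleR_wmean)
  finally have "(r * k' + k' + d) *\<^sub>R f (wmean3 a x b y c z) =
      (r * k') *\<^sub>R f x + k' *\<^sub>R f y + d *\<^sub>R f z"
    using k' by (simp add: algebra_simps)
  with that k' kd show thesis
    unfolding r_def by blast
qed

text \<open>Any barycentric coordinates of the image are proportional to those given by the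
  cevian.\<close>

lemma cevian_ratio:
  assumes "x \<in> D" "y \<in> D" "z \<in> D" "a > 0" "b > 0" "c > 0"
    and "\<not> collinear {f x, f y, f z}" "a' + b' + c' \<noteq> 0"
    and "(a' + b' + c') *\<^sub>R f (wmean3 a x b y c z) = a' *\<^sub>R f x + b' *\<^sub>R f y + c' *\<^sub>R f z"
  shows "a' = ratio x y (a / b) * b'"
proof -
  obtain k d where kd: "k > 0" "d > 0"
    "(ratio x y (a / b) * k + k + d) *\<^sub>R f (wmean3 a x b y c z) =
      (ratio x y (a / b) * k) *\<^sub>R f x + k *\<^sub>R f y + d *\<^sub>R f z"
    using cevian assms(1-6) by metis
  have "ratio x y (a / b) > 0"
    using assms ratio_pos by simp
  then have "ratio x y (a / b) * k + k + d > 0"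
    using kd by (simp add: add_pos_pos)
  then have "(ratio x y (a / b) * k) * b' = a' * k"
    using barycentric_unique(1)[OF assms(7) _ assms(8) kd(3) assms(9)] by simp
  then show ?thesis
    using kd by simp
qed

lemma cevian_ratio_rotate:
  assumes "x \<in> D" "y \<in> D" "z \<in> D" "a > 0" "b > 0" "c > 0"
    and "\<not> collinear {f x, f y, f z}" "a' + b' + c' \<noteq> 0"
    and "(a' + b' + c') *\<^sub>R f (wmean3 a x b y c z) = a' *\<^sub>R f x + b' *\<^sub>R f y + c' *\<^sub>R f z"
  shows "b' = ratio y z (b / c) * c'"
proof (rule cevian_ratio[of y z x b c a b' c' a'])
  show "\<not> collinear {f y, f z, f x}"
    using assms(7) by (simp add: insert_commute)
  show "(b' + c' + a') *\<^sub>R f (wmean3 b y c z a x) = b' *\<^sub>R f y + c' *\<^sub>R f z + a' *\<^sub>R f x"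
    using assms(9) wmean3_rotate[OF assms(4-6), of x y z] by (simp add: add.commute add.left_commute)
qed (use assms in \<open>auto simp: add.commute add.left_commute\<close>)

text \<open>The coordinates \<open>j\<close>, \<open>k\<close>, \<open>d\<close> of the image of one
  interior point have the three ratios as successive quotients; going once around the triangle
  returns to \<open>j\<close>.\<close>

lemma ceva:
  assumes D: "x \<in> D" "y \<in> D" "z \<in> D" and pos: "a > 0" "b > 0" "c > 0"
    and nc: "\<not> collinear {f x, f y, f z}"
  shows "ratio x y (a / b) * ratio y z (b / c) * ratio z x (c / a) = 1"
proof -
  obtain k d where kd: "k > 0" "d > 0"
    "(ratio x y (a / b) * k + k + d) *\<^sub>R f (wmean3 a x b y c z) =
      (ratio x y (a / b) * k) *\<^sub>R f x + k *\<^sub>R f y + d *\<^sub>R f z"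
    using cevian assms by metis
  define j where "j = ratio x y (a / b) * k"
  have j: "j > 0"
    using assms ratio_pos kd by (simp add: j_def)
  have e: "(j + k + d) *\<^sub>R f (wmean3 a x b y c z) = j *\<^sub>R f x + k *\<^sub>R f y + d *\<^sub>R f z"
    using kd by (simp add: j_def)
  have "k = ratio y z (b / c) * d"
    using cevian_ratio_rotate[OF D pos nc _ e] j kd by simp
  moreover have "d = ratio z x (c / a) * j"
  proof (rule cevian_ratio_rotate[of y z x b c a k d j])
    show "\<not> collinear {f y, f z, f x}"
      using nc by (simp add: insert_commute)
    show "(k + d + j) *\<^sub>R f (wmean3 b y c z a x) = k *\<^sub>R f y + d *\<^sub>R f z + j *\<^sub>R f x"
      using e wmean3_rotate[OF pos, of x y z] by (simp add: add.commute add.left_commute)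
  qed (use assms j kd in auto)
  ultimately have "j = ratio x y (a / b) * (ratio y z (b / c) * (ratio z x (c / a) * j))"
    using j_def by metis
  then show ?thesis
    using j by simp
qed

text \<open>Ceva's theorem for all weights gives multiplicativity; a segment joining two side
  midpoints gives the additive rule that singles out the identity among multiplicative
  functions.\<close>

lemma ratio_linear_nc:
  assumes D: "x \<in> D" "y \<in> D" "z \<in> D" and nc: "\<not> collinear {f x, f y, f z}" and "s > 0"
  shows "ratio x y s = ratio x y 1 * s"
proof -
  define \<phi> \<eta> \<theta> where "\<phi> = ratio x y" and "\<eta> = ratio y z" and "\<theta> = ratio z x"
  have pos: "\<phi> s > 0" "\<eta> s > 0" "\<theta> s > 0" if "s > 0" for s
    using that D ratio_pos by (simp_all add: \<phi>_def \<eta>_def \<theta>_def)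
  have ceva': "\<phi> s * \<eta> t * \<theta> (1 / (s * t)) = 1" if "s > 0" "t > 0" for s t
    using ceva[OF D _ _ _ nc, of "s * t" t 1] that by (simp add: \<phi>_def \<eta>_def \<theta>_def)
  \<comment> \<open>The third factor in Ceva's product depends only on \<open>s * t\<close>, so the
    pair \<open>s\<close>, \<open>t\<close> may be replaced by \<open>s * t\<close>,
    \<open>1\<close>.\<close>
  have shift_arg: "\<phi> s * \<eta> t = \<phi> (s * t) * \<eta> 1" if "s > 0" "t > 0" for s t
  proof -
    have "\<theta> (1 / (s * t)) \<noteq> 0"
      using pos(3)[of "1 / (s * t)"] that by simp
    moreover have "\<phi> s * \<eta> t * \<theta> (1 / (s * t)) = \<phi> (s * t) * \<eta> 1 * \<theta> (1 / (s * t))"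
      using ceva'[OF that] ceva'[of "s * t" 1] that by simp
    ultimately show ?thesis
      by simp
  qed
  txt \<open>By Ceva's theorem \<open>\<phi>\<close>, \<open>\<eta>\<close>, \<open>\<theta>\<close> satisfy a multiplicative Pexider equation, so
    \<open>\<psi>\<close> is multiplicative.\<close>
  define \<psi> where "\<psi> s = \<phi> s / \<phi> 1" for s
  have p1: "\<phi> 1 > 0" "\<eta> 1 > 0"
    using pos by auto
  have \<phi>: "\<phi> s = \<phi> 1 * \<psi> s" for s
    using p1 by (simp add: \<psi>_def)
  have \<eta>: "\<eta> s = \<eta> 1 * \<psi> s" if "s > 0" for s
    using shift_arg[of 1 s] that p1 by (simp add: \<psi>_def field_simps)
  have \<psi>_pos: "\<psi> s > 0" if "s > 0" for s
    using that pos p1 by (simp add: \<psi>_def)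
  have \<psi>_mult: "\<psi> (s * t) = \<psi> s * \<psi> t" if "s > 0" "t > 0" for s t
    using shift_arg[OF that] \<phi>[of s] \<eta>[OF that(2)] \<phi>[of "s * t"] p1 by simp
  have \<psi>_shift: "\<psi> (1 + t) = 1 + \<psi> t" if t: "t > 0" for t
  proof -
    txt \<open>The point with weights \<open>1 : 1 + t : t\<close> lies on the segment joining the midpoints of two
      sides, a line through no vertex.\<close>
    define p q where "p = wmean 1 x 1 y" and "q = wmean 1 y 1 z"
    have "p \<in> D" "q \<in> D"
      using D wmean_in by (simp_all add: p_def q_def)
    \<comment> \<open>The weights 2 and \<open>2 * t\<close> cancel the halves in the midpoints:
      \<open>2 p + 2 t q = x + (1 + t) y + t z\<close>.\<close>
    then obtain c d where cd: "c > 0" "d > 0" "f (wmean 2 p (2 * t) q) = wmean c (f p) d (f q)"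
      using image_wmean[of p q 2 "2 * t"] t by auto
    have w: "wmean3 1 x (1 + t) y t z = wmean 2 p (2 * t) q"
    proof -
      have "(2 + 2 * t) *\<^sub>R wmean 2 p (2 * t) q = (1 + 1) *\<^sub>R p + t *\<^sub>R ((1 + 1) *\<^sub>R q)"
        using t scaleR_wmean[of 2 "2 * t" p q] by (simp add: mult.commute)
      also have "\<dots> = 1 *\<^sub>R x + (1 + t) *\<^sub>R y + t *\<^sub>R z"
        unfolding p_def q_def by (subst (1 2) scaleR_wmean) (simp_all add: algebra_simps)
      also have "\<dots> = (1 + (1 + t)) *\<^sub>R wmean 1 x (1 + t) y + t *\<^sub>R z"
        using t by (subst scaleR_wmean) simp_all
      finally show ?thesis
        unfolding wmean3_def using t by (intro wmean_eqI) (simp_all add: algebra_simps)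
    qed
    define c' d' where "c' = c / (\<phi> 1 + 1)" and "d' = d / (\<eta> 1 + 1)"
    have c': "c = c' * (\<phi> 1 + 1)" "c' > 0" and d': "d = d' * (\<eta> 1 + 1)" "d' > 0"
      using p1 cd by (simp_all add: c'_def d'_def)
    have fp: "f p = wmean (\<phi> 1) (f x) 1 (f y)" and fq: "f q = wmean (\<eta> 1) (f y) 1 (f z)"
      using D image_wmean_1 by (simp_all add: p_def q_def \<phi>_def \<eta>_def)
    have cfp: "c *\<^sub>R f p = c' *\<^sub>R (\<phi> 1 *\<^sub>R f x + 1 *\<^sub>R f y)"
      using p1 by (simp only: c'(1) fp scaleR_scaleR[symmetric] scaleR_wmean)
    have dfq: "d *\<^sub>R f q = d' *\<^sub>R (\<eta> 1 *\<^sub>R f y + 1 *\<^sub>R f z)"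
      using p1 by (simp only: d'(1) fq scaleR_scaleR[symmetric] scaleR_wmean)
    \<comment> \<open>The coefficient of \<open>f y\<close> has two sources: \<open>c'\<close> comes
      from \<open>f p\<close> and \<open>e\<close> from \<open>f q\<close>.\<close>
    define e where "e = d' * \<eta> 1"
    have e: "e > 0"
      using d' p1 by (simp add: e_def)
    have "(c + d) *\<^sub>R f (wmean3 1 x (1 + t) y t z) =
        c' *\<^sub>R (\<phi> 1 *\<^sub>R f x + 1 *\<^sub>R f y) + d' *\<^sub>R (\<eta> 1 *\<^sub>R f y + 1 *\<^sub>R f z)"
      using cd cfp dfq by (simp add: w scaleR_wmean)
    moreover have "c + d = c' * \<phi> 1 + (c' + e) + d'"
      using c'(1) d'(1) by (simp add: e_def algebra_simps)
    ultimately have bary: "(c' * \<phi> 1 + (c' + e) + d') *\<^sub>R f (wmean3 1 x (1 + t) y t z) =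
        (c' * \<phi> 1) *\<^sub>R f x + (c' + e) *\<^sub>R f y + d' *\<^sub>R f z"
      by (simp add: e_def algebra_simps)
    have sum: "c' * \<phi> 1 + (c' + e) + d' \<noteq> 0"
      using c' d' e p1 by (smt (verit) mult_pos_pos)
    have t1: "1 + t > 0"
      using t by simp
    \<comment> \<open>The weights \<open>1 : 1 + t : t\<close> are now compared with the image
      coordinates along two sides. The first side gives \<open>\<psi> (1 + t) = 1 + e / c'\<close>,
      the second identifies \<open>e / c'\<close> with \<open>\<psi> t\<close>.\<close>
    have "c' * \<phi> 1 = \<phi> (1 / (1 + t)) * (c' + e)"
      using cevian_ratio[OF D zero_less_one t1 t nc sum bary] by (simp add: \<phi>_def)
    then have 1: "c' = \<psi> (1 / (1 + t)) * (c' + e)"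
      using p1 by (simp add: \<psi>_def field_simps)
    have "c' + e = \<eta> ((1 + t) / t) * d'"
      using cevian_ratio_rotate[OF D zero_less_one t1 t nc sum bary] by (simp add: \<eta>_def)
    then have 2: "c' + e = \<psi> ((1 + t) / t) * e"
      using \<eta>[of "(1 + t) / t"] t t1 by (simp add: e_def)
    have "\<psi> 1 = 1"
      using p1 by (simp add: \<psi>_def)
    then have "\<psi> (1 + t) * c' = c' + e"
      using \<psi>_mult[of "1 + t" "1 / (1 + t)"] t1 by (subst 1) simp
    then have 3: "\<psi> (1 + t) = 1 + e / c'"
      using c' by (simp add: field_simps)
    have "\<psi> (1 + t) = \<psi> ((1 + t) / t) * \<psi> t"
      using \<psi>_mult[of "(1 + t) / t" t] t t1 by simp
    then have "\<psi> (1 + t) * e = (c' + e) * \<psi> t"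
      using 2 by simp
    moreover have "(c' + e) = c' * (1 + e / c')"
      using c' by (simp add: field_simps)
    ultimately have "(1 + e / c') * e = (1 + e / c') * (c' * \<psi> t)"
      using 3 by simp
    moreover have "1 + e / c' > 0"
      using e c' by (simp add: add_pos_pos)
    ultimately have "e = c' * \<psi> t"
      by (metis less_irrefl mult_left_cancel)
    then have "\<psi> t = e / c'"
      using c' by simp
    with 3 show ?thesis
      by simp
  qed
  have "\<psi> s = s"
    using multiplicative_additive_shift_eq_id[of \<psi>, OF \<psi>_pos \<psi>_mult \<psi>_shift \<open>s > 0\<close>] .
  then show ?thesis
    using \<phi>[of s] by (simp add: \<phi>_def)
qed

text \<open>If every vertex of a nondegenerate image triangle lay on the line through
  \<open>X\<close> and \<open>Y\<close>, the triangle would be collinear.\<close>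

lemma ex_off_line:
  assumes "X \<noteq> Y"
  obtains w where "w \<in> D" "\<not> collinear {X, Y, f w}"
proof -
  obtain x y z where D: "x \<in> D" "y \<in> D" "z \<in> D" and nc: "\<not> collinear {f x, f y, f z}"
    using noncollinear unfolding non_collinear_def by blast
  have "\<not> collinear {X, Y, f x, f y, f z}"
    using nc collinear_subset[of "{X, Y, f x, f y, f z}" "{f x, f y, f z}"] by blast
  then show thesis
    using collinear_triples[OF assms, of "{f x, f y, f z}"] D that by blast
qed

section \<open>The cocycle of midpoint distortions\<close>

definition rho :: "'a \<Rightarrow> 'a \<Rightarrow> real" where
  "rho x y = ratio x y 1"

lemma rho_pos: "x \<in> D \<Longrightarrow> y \<in> D \<Longrightarrow> rho x y > 0"
  by (simp add: rho_def ratio_pos)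

lemma ratio_eq_rho:
  assumes "x \<in> D" "y \<in> D" "f x \<noteq> f y" "s > 0"
  shows "ratio x y s = rho x y * s"
  using ex_off_line[OF assms(3)] ratio_linear_nc assms unfolding rho_def by metis

lemma image_wmean_rho:
  assumes "x \<in> D" "y \<in> D" "f x \<noteq> f y" "a > 0" "b > 0"
  shows "f (wmean a x b y) = wmean (a * rho x y) (f x) b (f y)"
proof -
  have "f (wmean a x b y) = wmean (rho x y * (a / b)) (f x) 1 (f y)"
    using image_wmean_ratio ratio_eq_rho assms by simp
  also have "\<dots> = wmean (b * (rho x y * (a / b))) (f x) (b * 1) (f y)"
    using assms by (intro wmean_scale[symmetric]) simp
  finally show ?thesis
    using assms by (simp add: mult.commute)
qed

text \<open>The midpoint does not depend on the order of the endpoints, and the weights of its image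
  are unique up to scaling.\<close>

lemma rho_inverse:
  assumes "x \<in> D" "y \<in> D" "f x \<noteq> f y"
  shows "rho x y * rho y x = 1"
proof -
  have "wmean (rho x y) (f x) 1 (f y) = wmean (rho y x) (f y) 1 (f x)"
    using image_wmean_rho[of x y 1 1] image_wmean_rho[of y x 1 1] assms wmean_commute[of 1 x 1 y]
    by simp
  then have "wmean (rho x y) (f x) 1 (f y) = wmean 1 (f x) (rho y x) (f y)"
    using wmean_commute by metis
  then show ?thesis
    using wmean_unique[of "f x" "f y" "rho x y" 1 1 "rho y x"] assms rho_pos[of x y] rho_pos[of y x]
    by simp
qed

text \<open>Ceva's theorem at the centroid, with the factor \<open>rho z x\<close> inverted.\<close>

lemma rho_trans_nc:
  assumes "x \<in> D" "y \<in> D" "z \<in> D" "\<not> collinear {f x, f y, f z}"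
  shows "rho x z = rho x y * rho y z"
proof -
  have "f x \<noteq> f z"
    using assms(4) by (metis collinear_2 insert_absorb2 insert_commute)
  then have "rho x z * rho z x = 1"
    using rho_inverse assms by blast
  moreover have "rho x y * rho y z * rho z x = 1"
    using ceva[of x y z 1 1 1] assms by (simp add: rho_def)
  moreover have "rho z x \<noteq> 0"
    using rho_pos[of z x] assms by simp
  ultimately show ?thesis
    by (metis mult_right_cancel)
qed

text \<open>For collinear images a detour through a point \<open>w\<close> with image off the line
  makes every triangle used nondegenerate; the factors \<open>rho w y\<close> and
  \<open>rho y w\<close> cancel.\<close>

lemma rho_trans:
  assumes D: "x \<in> D" "y \<in> D" "z \<in> D" and ne: "f x \<noteq> f y" "f y \<noteq> f z" "f x \<noteq> f z"
  shows "rho x z = rho x y * rho y z"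
proof (cases "collinear {f x, f y, f z}")
  case True
  obtain w where w: "w \<in> D" "\<not> collinear {f x, f y, f w}"
    using ex_off_line[OF ne(1)] by blast
  have nc: "\<not> collinear {f x, f w, f z}" "\<not> collinear {f y, f w, f z}"
    using w(2) True ne collinear_3_trans[of "f y" "f x" "f z" "f w"]
      collinear_3_trans[of "f x" "f y" "f z" "f w"]
    by (simp_all add: insert_commute) blast+
  have "\<not> collinear {f x, f w, f y}"
    using w(2) by (simp add: insert_commute)
  then have "rho x y * rho y z = rho x w * rho w y * (rho y w * rho w z)"
    using rho_trans_nc D w nc by metis
  also have "\<dots> = rho x w * (rho w y * rho y w) * rho w z"
    by (simp add: mult.assoc)
  also have "rho w y * rho y w = 1"
    using rho_inverse[of w y] w D by (metis collinear_2 insert_absorb2 insert_commute)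
  also have "rho x w * 1 * rho w z = rho x z"
    using rho_trans_nc[OF D(1) w(1) D(3) nc(1)] by simp
  finally show ?thesis
    by simp
qed (use rho_trans_nc D in blast)

section \<open>The denominator\<close>

text \<open>The natural choice is \<open>rho u x0\<close>, but it carries no information when
  \<open>f u = f x0\<close>. On that fibre the value is routed through \<open>y0\<close>, and the
  work is to show independence of the intermediate point.\<close>

lemma ex_weight:
  obtains g where "\<And>x. x \<in> D \<Longrightarrow> g x > 0"
    "\<And>x y. x \<in> D \<Longrightarrow> y \<in> D \<Longrightarrow> f x \<noteq> f y \<Longrightarrow> g x = rho x y * g y"
proof -
  obtain x0 y0 z0 where D: "x0 \<in> D" "y0 \<in> D" "z0 \<in> D" and nc: "\<not> collinear {f x0, f y0, f z0}"
    using noncollinear unfolding non_collinear_def by blast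
  have ne: "f x0 \<noteq> f y0" "f y0 \<noteq> f z0" "f x0 \<noteq> f z0"
    using nc by (metis collinear_2 insert_absorb2 insert_commute)+
  define g where "g u = (if f u = f x0 then rho u y0 * rho y0 x0 else rho u x0)" for u
  have indep: "rho u v * rho v x0 = rho u w * rho w x0"
    if "u \<in> D" "v \<in> D" "w \<in> D" "f u = f x0" "f v \<noteq> f x0" "f w \<noteq> f x0" "f v \<noteq> f w" for u v w
  proof -
    have "rho u v = rho u w * rho w v" "rho w x0 = rho w v * rho v x0"
      using that D rho_trans[of u w v] rho_trans[of w v x0] by simp_all
    then show ?thesis
      by simp
  qed
  have base: "g u = rho u v * rho v x0" if "u \<in> D" "v \<in> D" "f u = f x0" "f v \<noteq> f x0" for u v
  proof (cases "f v = f y0")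
    case True
    \<comment> \<open>\<open>indep\<close> needs intermediate points with distinct images, so
      \<open>v\<close> and \<open>y0\<close> are compared via \<open>z0\<close>.\<close>
    have "rho u v * rho v x0 = rho u z0 * rho z0 x0"
      using that D ne True by (intro indep) auto
    also have "\<dots> = rho u y0 * rho y0 x0"
      using that D ne by (intro indep) auto
    finally show ?thesis
      using that by (simp add: g_def)
  next
    case False
    then show ?thesis
      using indep[of u v y0] that D ne by (simp add: g_def)
  qed
  have right: "g u = rho u v * g v" if "u \<in> D" "v \<in> D" "f u \<noteq> f v" "f v \<noteq> f x0" for u v
  proof (cases "f u = f x0")
    case True
    then show ?thesis
      using base that by (simp add: g_def)
  next
    case False
    then show ?thesis
      using rho_trans[of u v x0] that D by (simp add: g_def)
  qed
  show thesis
  proof (rule that)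
    show "g x > 0" if "x \<in> D" for x
      using that D rho_pos by (simp add: g_def)
    show "g x = rho x y * g y" if "x \<in> D" "y \<in> D" "f x \<noteq> f y" for x y
    proof (cases "f y = f x0")
      case True
      \<comment> \<open>Here \<open>f x\<close> differs from \<open>f x0\<close>, so
        \<open>right\<close> applies with the roles exchanged and is then inverted.\<close>
      then have "g y = rho y x * g x"
        using right[of y x] that by simp
      then have "rho x y * g y = (rho x y * rho y x) * g x"
        by simp
      then show ?thesis
        using rho_inverse[OF that] by simp
    qed (use right that in blast)
  qed
qed

section \<open>Affinity of the weight\<close>

context
  fixes g :: "'a \<Rightarrow> real"
  assumes g_pos: "\<And>x. x \<in> D \<Longrightarrow> g x > 0"
    and g_rho: "\<And>x y. x \<in> D \<Longrightarrow> y \<in> D \<Longrightarrow> f x \<noteq> f y \<Longrightarrow> g x = rho x y * g y"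
begin

text \<open>Since \<open>rho x y = g x / g y\<close> for distinct images, scaling the weights by
  \<open>g y\<close> gives this symmetric form. For equal images all positive weights give the same
  point.\<close>

lemma image_wmean_weight:
  assumes "x \<in> D" "y \<in> D" "a > 0" "b > 0"
  shows "f (wmean a x b y) = wmean (a * g x) (f x) (b * g y) (f y)"
proof (cases "f x = f y")
  case True
  have const: "wmean c (f y) d (f y) = f y" if "c > 0" "d > 0" for c d
    using that by (intro wmean_eqI) (simp_all add: scaleR_add_left)
  obtain c d where "c > 0" "d > 0" "f (wmean a x b y) = wmean c (f x) d (f y)"
    using image_wmean[OF assms] by blast
  then show ?thesis
    using True const g_pos assms by simp
next
  case False
  have "wmean (a * g x) (f x) (b * g y) (f y) = wmean (g y * (a * rho x y)) (f x) (g y * b) (f y)"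
    using g_rho[OF assms(1,2) False] by (simp add: ac_simps)
  also have "\<dots> = wmean (a * rho x y) (f x) b (f y)"
    using g_pos[OF assms(2)] by (intro wmean_scale) simp
  finally show ?thesis
    using image_wmean_rho[OF assms(1,2) False assms(3,4)] by simp
qed

text \<open>The image of the point with weights \<open>a : b : 1\<close> in a triangle
  \<open>x\<close>, \<open>y\<close>, \<open>w\<close> is computed through \<open>m\<close> and
  along the side from \<open>y\<close> to \<open>w\<close>. Comparison forces \<open>k\<close>, the
  quotient of the two sides of the claim, to be 1.\<close>

lemma weight_wmean_ne:
  assumes xy: "x \<in> D" "y \<in> D" and ab: "a > 0" "b > 0" and ne: "f x \<noteq> f y"
  shows "(a + b) * g (wmean a x b y) = a * g x + b * g y"
proof -
  define m where "m = wmean a x b y"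
  have m: "m \<in> D"
    using wmean_in xy ab by (simp add: m_def)
  obtain w where w: "w \<in> D" "\<not> collinear {f x, f y, f w}"
    using ex_off_line[OF ne] by blast
  define G k where "G = a * g x + b * g y" and "k = (a + b) * g m / G"
  have pos: "g x > 0" "g y > 0" "g w > 0" "g m > 0"
    using g_pos xy w m by auto
  have G: "G > 0"
    using pos ab by (simp add: G_def add_pos_pos)
  have k: "k > 0" "(a + b) * g m = k * G"
    using pos ab G by (simp_all add: k_def)
  have Gm: "G *\<^sub>R f m = (a * g x) *\<^sub>R f x + (b * g y) *\<^sub>R f y"
    using image_wmean_weight[OF xy ab] scaleR_wmean[of "a * g x" "b * g y" "f x" "f y"] G
    by (simp add: m_def G_def)
  have ab': "a + b > 0"
    using ab by simp
  have "f (wmean3 a x b y 1 w) = wmean ((a + b) * g m) (f m) (1 * g w) (f w)"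
    unfolding wmean3_def m_def[symmetric] by (rule image_wmean_weight[OF m w(1) ab' zero_less_one])
  then have "f (wmean3 a x b y 1 w) = wmean (k * G) (f m) (g w) (f w)"
    unfolding k(2) by simp
  then have "(k * G + g w) *\<^sub>R f (wmean3 a x b y 1 w) = k *\<^sub>R (G *\<^sub>R f m) + g w *\<^sub>R f w"
    using scaleR_wmean[of "k * G" "g w" "f m" "f w"] add_pos_pos[of "k * G" "g w"] k(1) G pos by simp
  then have bary: "(k * (a * g x) + k * (b * g y) + g w) *\<^sub>R f (wmean3 a x b y 1 w) =
      (k * (a * g x)) *\<^sub>R f x + (k * (b * g y)) *\<^sub>R f y + g w *\<^sub>R f w"
    unfolding Gm by (simp add: G_def scaleR_add_right distrib_left)
  have sum: "k * (a * g x) + k * (b * g y) + g w \<noteq> 0"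
    using k G pos unfolding G_def by (metis add_pos_pos distrib_left less_irrefl mult_pos_pos)
  have "f y \<noteq> f w"
    using w(2) by (metis collinear_2 insert_absorb2)
  have "k * (b * g y) = ratio y w (b / 1) * g w"
    using cevian_ratio_rotate[OF xy w(1) ab zero_less_one w(2) sum bary] .
  also have "\<dots> = b * (rho y w * g w)"
    using ratio_eq_rho[OF xy(2) w(1) \<open>f y \<noteq> f w\<close>, of b] ab by simp
  also have "\<dots> = b * g y"
    using g_rho[OF xy(2) w(1) \<open>f y \<noteq> f w\<close>] by simp
  finally have "k = 1"
    using ab pos by simp
  then show ?thesis
    using k(2) by (simp add: G_def m_def)
qed

text \<open>For equal images the cocycle says nothing directly about \<open>g x\<close> and
  \<open>g y\<close>. Midpoints with a point \<open>w\<close> off the fibre reduce the claim to the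
  nondegenerate case, or show \<open>g\<close> equal at \<open>x\<close>, \<open>y\<close> and their
  mean.\<close>

lemma weight_wmean:
  assumes xy: "x \<in> D" "y \<in> D" and ab: "a > 0" "b > 0"
  shows "(a + b) * g (wmean a x b y) = a * g x + b * g y"
proof (cases "f x = f y")
  case True
  define m where "m = wmean a x b y"
  have m: "m \<in> D"
    using wmean_in xy ab by (simp add: m_def)
  have const: "wmean c p d p = p" if "c > 0" "d > 0" for c d and p :: 'b
    using that by (intro wmean_eqI) (simp_all add: scaleR_add_left)
  have fm: "f m = f y"
    using image_wmean_weight[OF xy ab] True const g_pos xy ab by (simp add: m_def)
  obtain w where w: "w \<in> D" "f w \<noteq> f y"
  proof -
    obtain p q r where pq: "p \<in> D" "q \<in> D" "\<not> collinear {f p, f q, f r}"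
      using noncollinear unfolding non_collinear_def by blast
    then have "f p \<noteq> f q"
      by (metis collinear_2 insert_absorb2)
    with pq that show thesis
      by metis
  qed
  txt \<open>The degenerate segment is moved halfway towards \<open>w\<close>.\<close>
  define x' y' m' where "x' = wmean 1 x 1 w" and "y' = wmean 1 y 1 w" and "m' = wmean 1 m 1 w"
  have D': "x' \<in> D" "y' \<in> D" "m' \<in> D"
    using wmean_in xy w m by (simp_all add: x'_def y'_def m'_def)
  have half: "2 * g (wmean 1 u 1 w) = g u + g w" if "u \<in> D" "f u = f y" for u
    using weight_wmean_ne[OF that(1) w(1), of 1 1] that w by simp
  have g': "2 * g x' = g x + g w" "2 * g y' = g y + g w" "2 * g m' = g m + g w"
    using half xy m True fm by (simp_all add: x'_def y'_def m'_def)
  \<comment> \<open>Moving halfway towards \<open>w\<close> is a homothety, so it preserves the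
    division ratio.\<close>
  have m': "m' = wmean a x' b y'"
  proof -
    have "a *\<^sub>R m + b *\<^sub>R m = a *\<^sub>R x + b *\<^sub>R y"
      using scaleR_wmean[of a b x y] ab by (simp add: m_def scaleR_add_left)
    then have "(a + b) *\<^sub>R ((1 + 1) *\<^sub>R m') = a *\<^sub>R ((1 + 1) *\<^sub>R x') + b *\<^sub>R ((1 + 1) *\<^sub>R y')"
      unfolding x'_def y'_def m'_def by (subst (1 2 3) scaleR_wmean) (simp_all add: algebra_simps)
    then have "2 *\<^sub>R ((a + b) *\<^sub>R m') = 2 *\<^sub>R (a *\<^sub>R x' + b *\<^sub>R y')"
      by (simp add: scaleR_add_right mult.commute)
    then have "(a + b) *\<^sub>R m' = a *\<^sub>R x' + b *\<^sub>R y'"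
      by (subst (asm) scaleR_cancel_left) simp
    then show ?thesis
      using ab by (intro wmean_eqI[symmetric]) auto
  qed
  show ?thesis
  proof (cases "f x' = f y'")
    case False
    have "(a + b) * g m' = a * g x' + b * g y'"
      using weight_wmean_ne[OF D'(1,2) ab False] m' by simp
    then have "(a + b) * (2 * g m') = a * (2 * g x') + b * (2 * g y')"
      by (simp add: algebra_simps)
    then show ?thesis
      unfolding g' by (simp add: m_def algebra_simps)
  next
    case True
    \<comment> \<open>On the segment from \<open>f y\<close> to \<open>f w\<close> the image of the
      midpoint determines the weight ratio \<open>g u : g w\<close>, hence
      \<open>g u\<close>.\<close>
    have eq: "g u = g v" if "u \<in> D" "v \<in> D" "f u = f y" "f v = f y"
      "f (wmean 1 u 1 w) = f (wmean 1 v 1 w)" for u v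
    proof -
      have "wmean (g u) (f y) (g w) (f w) = wmean (g v) (f y) (g w) (f w)"
        using image_wmean_weight[of u w 1 1] image_wmean_weight[of v w 1 1] that w by simp
      then have "g u * g w = g v * g w"
        using w g_pos[OF that(1)] g_pos[OF that(2)] g_pos[OF w(1)] by (intro wmean_unique) auto
      then show ?thesis
        using g_pos[OF w(1)] by simp
    qed
    have "f m' = f y'"
      using image_wmean_weight[OF D'(1,2) ab] True const g_pos D' ab by (simp add: m')
    then have "g m = g y"
      using fm m xy by (intro eq) (auto simp: m'_def y'_def)
    moreover have "g x = g y"
      using xy True \<open>f x = f y\<close> by (intro eq) (auto simp: x'_def y'_def)
    ultimately show ?thesis
      by (simp add: m_def algebra_simps)
  qed
qed (use weight_wmean_ne assms in blast)

end

section \<open>Numerator and denominator\<close>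

text \<open>Affinity of \<open>g\<close> makes the total weight \<open>a * g x + b * g y\<close>
  cancel in the image of a mean, so the product of \<open>g\<close> and \<open>f\<close> is affine
  too. Extending both maps gives the quotient.\<close>

lemma ex_linear_fractional:
  obtains A :: "'a \<Rightarrow> 'b" and B :: "'a \<Rightarrow> real" and a b where "linear A" "linear B"
    "\<And>x. x \<in> D \<Longrightarrow> B x + b > 0" "\<And>x. x \<in> D \<Longrightarrow> f x = (A x + a) /\<^sub>R (B x + b)"
proof -
  obtain g where g: "\<And>x. x \<in> D \<Longrightarrow> g x > 0"
    "\<And>x y. x \<in> D \<Longrightarrow> y \<in> D \<Longrightarrow> f x \<noteq> f y \<Longrightarrow> g x = rho x y * g y"
    using ex_weight by blast
  have ne: "D \<noteq> {}"
    using noncollinear by (auto simp: non_collinear_def)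
  have g_affine: "(a + b) * g (wmean a x b y) = a * g x + b * g y"
    if "x \<in> D" "y \<in> D" "a > 0" "b > 0" for x y a b
    using weight_wmean[OF g that] .
  obtain B b where B: "linear B" "\<And>x. x \<in> D \<Longrightarrow> g x = B x + b"
  proof (rule affine_on_convex_extend[OF convex ne, of g])
    show "g (wmean a x b y) = wmean a (g x) b (g y)" if "x \<in> D" "y \<in> D" "a > 0" "b > 0" for x y a b
      by (rule wmean_eqI[symmetric]) (use that g_affine[OF that] in auto)
  qed blast
  obtain A a where A: "linear A" "\<And>x. x \<in> D \<Longrightarrow> g x *\<^sub>R f x = A x + a"
  proof (rule affine_on_convex_extend[OF convex ne, of "\<lambda>x. g x *\<^sub>R f x"])
    fix x y :: 'a and a b :: real
    assume *: "x \<in> D" "y \<in> D" "a > 0" "b > 0"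
    have "(a + b) *\<^sub>R (g (wmean a x b y) *\<^sub>R f (wmean a x b y)) =
        (a * g x + b * g y) *\<^sub>R wmean (a * g x) (f x) (b * g y) (f y)"
      using g_affine[OF *] image_wmean_weight[OF g *] by simp
    also have "\<dots> = a *\<^sub>R (g x *\<^sub>R f x) + b *\<^sub>R (g y *\<^sub>R f y)"
    proof -
      have "a * g x + b * g y > 0"
        using * g(1) by (simp add: add_pos_pos)
      then show ?thesis
        by (simp add: scaleR_wmean)
    qed
    finally show "g (wmean a x b y) *\<^sub>R f (wmean a x b y) = wmean a (g x *\<^sub>R f x) b (g y *\<^sub>R f y)"
      using * by (intro wmean_eqI[symmetric]) auto
  qed blast
  show thesis
  proof (rule that[OF A(1) B(1)])
    fix x assume x: "x \<in> D"
    show "B x + b > 0"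
      using g(1)[OF x] B(2)[OF x] by simp
    show "f x = (A x + a) /\<^sub>R (B x + b)"
      unfolding A(2)[OF x, symmetric] B(2)[OF x, symmetric] using g(1)[OF x] by simp
  qed
qed

end

theorem theorem2:
  fixes D :: "'a::real_vector set" and f :: "'a \<Rightarrow> 'b::real_vector"
  assumes "D \<noteq> {}" and "convex D"
    and "strict_inv_convexity_preserving D f"
    and "non_collinear (f ` D)"
  shows "\<exists>(A :: 'a \<Rightarrow> 'b) (B :: 'a \<Rightarrow> real) (a :: 'b) (b :: real).
           linear A \<and> linear B \<and>
           (\<forall>x\<in>D. B x + b > 0) \<and>
           (\<forall>x\<in>D. f x = (A x + a) /\<^sub>R (B x + b))"
proof -
  interpret noncollinear_icp D f
    by unfold_locales (use assms in auto)
  show ?thesis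
    using ex_linear_fractional by metis
qed

end
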